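(* Let $H$ be a tournament with $|V(H)| = 4$. Then WMISP restricted to $H$-free tournaments can be solved in polynomial time (in the number of vertices of the input tournament).
   Context: All tournaments are finite. A subtournament of a tournament $G$ is an induced subgraph of $G$. A tournament $G$ is $H$-free if no subtournament of $G$ is isomorphic to $H$. A tournament is transitive if it has no directed cycle (equivalently, no cyclic triangle). A set $X \subseteq V(G)$ is called independent if the subtournament $G[X]$ is transitive. WMISP (weighted maximum independent set problem for tournaments): given a tournament $G$ and a weight function $w: V(G) \to \mathbb{Q}_+$, find the maximum of $w(S)=\sum_{v\in S} w(v)$ over independent sets $S$ of $G$. *)

theory Defs
  imports
    "Graph_Theory.Digraph_Isomorphism"
    "HOL-Computational_Algebra.Polynomial"
begin

section \<open>Tournaments and the weighted maximum independent set problem\<close>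

locale tournament = digraph +
  assumes exactly_one_arc:
    "\<lbrakk>u \<in> verts G; v \<in> verts G; u \<noteq> v\<rbrakk> \<Longrightarrow> u \<rightarrow>\<^bsub>G\<^esub> v \<longleftrightarrow> \<not> v \<rightarrow>\<^bsub>G\<^esub> u"

definition free_of :: "('c, 'd) pre_digraph \<Rightarrow> ('a, 'b) pre_digraph \<Rightarrow> bool" where
  "free_of H G \<longleftrightarrow> \<not> (\<exists>G'. induced_subgraph G' G \<and> digraph_iso G' H)"

definition transitive :: "('a, 'b) pre_digraph \<Rightarrow> bool" where
  "transitive G \<longleftrightarrow> \<not> (\<exists>p. pre_digraph.cycle G p)"

definition independent :: "('a, 'b) pre_digraph \<Rightarrow> 'a set \<Rightarrow> bool" where
  "independent G X \<longleftrightarrow> X \<subseteq> verts G \<and> transitive (G \<restriction> X)"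

definition max_independent_weight :: "('a, 'b) pre_digraph \<Rightarrow> ('a \<Rightarrow> rat) \<Rightarrow> rat" where
  "max_independent_weight G w = Max {(\<Sum>v\<in>S. w v) | S. independent G S}"

section \<open>The model of computation\<close>

text \<open>
  Algorithms are while programs for a random access machine which has registers and
  indirectly addressed memory, both for natural numbers (indices, addresses, adjacency bits)
  and for rational numbers (weights). Every elementary instruction and every evaluation of a
  test takes one unit of time.

  There is deliberately no multiplication or division. In \<^emph>\<open>t\<close> steps a program produces only
  natural numbers of size \<^emph>\<open>O(2^t)\<close> times the largest input number, and only integer
  combinations of the input weights with coefficients of absolute value at most \<^emph>\<open>2^t\<close>; so
  unit cost hides no superpolynomial work, and a polynomial number of steps is polynomial
  time on a Turing machine as well.
\<close>

record ram_state =
  ireg :: "nat \<Rightarrow> nat"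
  imem :: "nat \<Rightarrow> nat"
  qreg :: "nat \<Rightarrow> rat"
  qmem :: "nat \<Rightarrow> rat"

datatype instr =
    IConst nat nat
  | IAdd nat nat nat
  | ISub nat nat nat
  | ILoad nat nat
  | IStore nat nat
  | QAdd nat nat nat
  | QSub nat nat nat
  | QLoad nat nat
  | QStore nat nat

text \<open>
  The first argument of an instruction is its target register; for the two store
  instructions it is the register that holds the target address. Subtraction of
  natural numbers is truncated at 0.
\<close>

fun instr_step :: "instr \<Rightarrow> ram_state \<Rightarrow> ram_state" where
  "instr_step (IConst r k) s = s\<lparr>ireg := (ireg s)(r := k)\<rparr>"
| "instr_step (IAdd r a b) s = s\<lparr>ireg := (ireg s)(r := ireg s a + ireg s b)\<rparr>"
| "instr_step (ISub r a b) s = s\<lparr>ireg := (ireg s)(r := ireg s a - ireg s b)\<rparr>"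
| "instr_step (ILoad r a) s = s\<lparr>ireg := (ireg s)(r := imem s (ireg s a))\<rparr>"
| "instr_step (IStore a r) s = s\<lparr>imem := (imem s)(ireg s a := ireg s r)\<rparr>"
| "instr_step (QAdd r a b) s = s\<lparr>qreg := (qreg s)(r := qreg s a + qreg s b)\<rparr>"
| "instr_step (QSub r a b) s = s\<lparr>qreg := (qreg s)(r := qreg s a - qreg s b)\<rparr>"
| "instr_step (QLoad r a) s = s\<lparr>qreg := (qreg s)(r := qmem s (ireg s a))\<rparr>"
| "instr_step (QStore a r) s = s\<lparr>qmem := (qmem s)(ireg s a := qreg s r)\<rparr>"

datatype test = ILess nat nat | QLess nat nat

fun test_holds :: "test \<Rightarrow> ram_state \<Rightarrow> bool" where
  "test_holds (ILess a b) s \<longleftrightarrow> ireg s a < ireg s b"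
| "test_holds (QLess a b) s \<longleftrightarrow> qreg s a < qreg s b"

datatype program =
    Skip
  | Instr instr
  | Seq program program
  | Cond test program program
  | While test program

text \<open>\<open>exec c s t s'\<close>: started in \<open>s\<close>, the program \<open>c\<close> halts in \<open>s'\<close> after time \<open>t\<close>.\<close>

inductive exec :: "program \<Rightarrow> ram_state \<Rightarrow> nat \<Rightarrow> ram_state \<Rightarrow> bool" where
  Skip: "exec Skip s 1 s"
| Instr: "exec (Instr i) s 1 (instr_step i s)"
| Seq: "\<lbrakk>exec c\<^sub>1 s\<^sub>1 t\<^sub>1 s\<^sub>2; exec c\<^sub>2 s\<^sub>2 t\<^sub>2 s\<^sub>3\<rbrakk> \<Longrightarrow> exec (Seq c\<^sub>1 c\<^sub>2) s\<^sub>1 (t\<^sub>1 + t\<^sub>2) s\<^sub>3"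
| CondTrue: "\<lbrakk>test_holds b s; exec c\<^sub>1 s t s'\<rbrakk> \<Longrightarrow> exec (Cond b c\<^sub>1 c\<^sub>2) s (1 + t) s'"
| CondFalse: "\<lbrakk>\<not> test_holds b s; exec c\<^sub>2 s t s'\<rbrakk> \<Longrightarrow> exec (Cond b c\<^sub>1 c\<^sub>2) s (1 + t) s'"
| WhileFalse: "\<not> test_holds b s \<Longrightarrow> exec (While b c) s 1 s"
| WhileTrue: "\<lbrakk>test_holds b s\<^sub>1; exec c s\<^sub>1 t\<^sub>1 s\<^sub>2; exec (While b c) s\<^sub>2 t\<^sub>2 s\<^sub>3\<rbrakk>
    \<Longrightarrow> exec (While b c) s\<^sub>1 (1 + t\<^sub>1 + t\<^sub>2) s\<^sub>3"

inductive_cases SkipE: "exec Skip s t s'"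
  and InstrE: "exec (Instr i) s t s'"
  and SeqE: "exec (Seq c\<^sub>1 c\<^sub>2) s t s'"
  and CondE: "exec (Cond b c\<^sub>1 c\<^sub>2) s t s'"
  and WhileE: "exec (While b c) s t s'"

lemma exec_deterministic:
  "\<lbrakk>exec c s t s'; exec c s u s''\<rbrakk> \<Longrightarrow> t = u \<and> s' = s''"
proof (induction arbitrary: u s'' rule: exec.induct)
  case Skip
  then show ?case by (auto elim: SkipE)
next
  case Instr
  then show ?case by (auto elim: InstrE)
next
  case (Seq c\<^sub>1 s\<^sub>1 t\<^sub>1 s\<^sub>2 c\<^sub>2 t\<^sub>2 s\<^sub>3)
  from Seq.prems obtain u\<^sub>1 r u\<^sub>2 where
    "u = u\<^sub>1 + u\<^sub>2" "exec c\<^sub>1 s\<^sub>1 u\<^sub>1 r" "exec c\<^sub>2 r u\<^sub>2 s''"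
    by (rule SeqE)
  then show ?case using Seq.IH by blast
next
  case (CondTrue b s c\<^sub>1 t s' c\<^sub>2)
  from CondTrue.prems obtain v where "u = 1 + v" "exec c\<^sub>1 s v s''"
    using CondTrue.hyps by (elim CondE) auto
  then show ?case using CondTrue.IH by blast
next
  case (CondFalse b s c\<^sub>2 t s' c\<^sub>1)
  from CondFalse.prems obtain v where "u = 1 + v" "exec c\<^sub>2 s v s''"
    using CondFalse.hyps by (elim CondE) auto
  then show ?case using CondFalse.IH by blast
next
  case WhileFalse
  from WhileFalse.prems show ?case by (rule WhileE) (use WhileFalse.hyps in simp_all)
next
  case (WhileTrue b s\<^sub>1 c t\<^sub>1 s\<^sub>2 t\<^sub>2 s\<^sub>3)
  from WhileTrue.prems obtain u\<^sub>1 r u\<^sub>2 where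
    "u = 1 + u\<^sub>1 + u\<^sub>2" "exec c s\<^sub>1 u\<^sub>1 r" "exec (While b c) r u\<^sub>2 s''"
    by (rule WhileE) (use WhileTrue.hyps in auto)
  then show ?case using WhileTrue.IH by blast
qed

text \<open>
  The input is a weighted digraph with vertices listed as \<open>vs\<close>: the number \<open>n\<close> of vertices is
  in integer register 0, the adjacency matrix is stored row by row in the integer memory, and
  the weights are stored in the rational memory. Everything else is 0.
\<close>

definition input_state :: "('a, 'b) pre_digraph \<Rightarrow> ('a \<Rightarrow> rat) \<Rightarrow> 'a list \<Rightarrow> ram_state" where
  "input_state G w vs = (let n = length vs in
     \<lparr>ireg = (\<lambda>_. 0)(0 := n),
      imem = (\<lambda>a. if a < n * n \<and> vs ! (a div n) \<rightarrow>\<^bsub>G\<^esub> vs ! (a mod n) then 1 else 0),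
      qreg = (\<lambda>_. 0),
      qmem = (\<lambda>a. if a < n then w (vs ! a) else 0)\<rparr>)"

definition result :: "ram_state \<Rightarrow> rat" where
  "result s = qreg s 0"

text \<open>
  Vertices and arcs of the input digraphs are drawn from fixed countably infinite types; up to
  isomorphism this covers all finite digraphs. One program has to work for inputs of all sizes
  and for every listing of the vertices.
\<close>

definition WMISP_in_polynomial_time :: "(nat, nat \<times> nat) pre_digraph set \<Rightarrow> bool" where
  "WMISP_in_polynomial_time \<C> \<longleftrightarrow>
     (\<exists>(c :: program) (p :: nat poly).
        \<forall>G \<in> \<C>. \<forall>w vs.
          (\<forall>v \<in> verts G. 0 \<le> w v) \<longrightarrow> distinct vs \<longrightarrow> set vs = verts G \<longrightarrow>
          (\<exists>t s. exec c (input_state G w vs) t s \<and>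
                 t \<le> poly p (card (verts G)) \<and>
                 result s = max_independent_weight G w))"

end

theory Submission
  imports Defs
begin

text \<open>
  A set of vertices of a tournament is independent iff it contains no cyclic triangle, and a
  nonempty independent set has a source. There are four tournaments with four vertices.

  \<^item> If the transitive one is excluded, independent sets have at most three elements, so it
    suffices to try all triples.
  \<^item> If a vertex dominating a cyclic triangle is excluded, the out-neighbourhood of every vertex is
    independent. Hence a maximum independent set is a vertex together with all its
    out-neighbours. A vertex dominated by a cyclic triangle is the same case for the
    reversed tournament.
  \<^item> If the strong one is excluded, a vertex outside a cyclic triangle dominates it or is dominated
    by it, so the cyclic triangles are disjoint and it is optimal to delete a lightest vertex
    of each of them.
\<close>

section \<open>Tournament relations\<close>

definition triangle_free :: "('a \<Rightarrow> 'a \<Rightarrow> bool) \<Rightarrow> 'a set \<Rightarrow> bool" where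
  "triangle_free E S \<longleftrightarrow> (\<forall>a\<in>S. \<forall>b\<in>S. \<forall>c\<in>S. \<not> (E a b \<and> E b c \<and> E c a))"

definition transitive4 :: "('a \<Rightarrow> 'a \<Rightarrow> bool) \<Rightarrow> 'a \<Rightarrow> 'a \<Rightarrow> 'a \<Rightarrow> 'a \<Rightarrow> bool" where
  "transitive4 E a b c d \<longleftrightarrow> E a b \<and> E a c \<and> E a d \<and> E b c \<and> E b d \<and> E c d"

text \<open>The fourth tournament, a vertex dominated by a cyclic triangle, has no definition of its
  own: it is \<open>winner4\<close> of the reversed relation.\<close>

definition winner4 :: "('a \<Rightarrow> 'a \<Rightarrow> bool) \<Rightarrow> 'a \<Rightarrow> 'a \<Rightarrow> 'a \<Rightarrow> 'a \<Rightarrow> bool" where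
  "winner4 E a b c d \<longleftrightarrow> E a b \<and> E a c \<and> E a d \<and> E b c \<and> E c d \<and> E d b"

text \<open>A Hamiltonian cycle with both diagonals; other orientations of the diagonals only
  relabel the same tournament.\<close>

definition strong4 :: "('a \<Rightarrow> 'a \<Rightarrow> bool) \<Rightarrow> 'a \<Rightarrow> 'a \<Rightarrow> 'a \<Rightarrow> 'a \<Rightarrow> bool" where
  "strong4 E a b c d \<longleftrightarrow> E a b \<and> E b c \<and> E c d \<and> E d a \<and> E a c \<and> E b d"

lemmas pattern4_defs = transitive4_def winner4_def strong4_def

lemma triangle_free_converse: "triangle_free (\<lambda>u v. E v u) S \<longleftrightarrow> triangle_free E S"
  unfolding triangle_free_def by blast

text \<open>Arcs are confined to V, so that forbidden patterns can be stated for all a, b, c, d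
  without membership conditions.\<close>

locale tournament_rel =
  fixes V :: "'a set" and E :: "'a \<Rightarrow> 'a \<Rightarrow> bool"
  assumes finite_V: "finite V"
    and E_in_V: "E u v \<Longrightarrow> u \<in> V \<and> v \<in> V"
    and E_asym: "E u v \<Longrightarrow> \<not> E v u"
    and E_total: "\<lbrakk>u \<in> V; v \<in> V; u \<noteq> v\<rbrakk> \<Longrightarrow> E u v \<or> E v u"
begin

lemma converse: "tournament_rel V (\<lambda>u v. E v u)"
  using finite_V E_in_V E_asym E_total by unfold_locales blast+

lemma irrefl: "\<not> E u u"
  using E_asym by blast

lemma triangle_free_trans:
  assumes "triangle_free E S" "S \<subseteq> V" "a \<in> S" "b \<in> S" "c \<in> S" "E a b" "E b c"
  shows "E a c"
  using assms E_asym E_total unfolding triangle_free_def by (metis subsetD)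

text \<open>No element of the enlarged set has an arc to a, so no cyclic triangle passes through
  a.\<close>

lemma triangle_free_insert_source:
  assumes "triangle_free E S" "\<And>v. v \<in> S \<Longrightarrow> E a v"
  shows "triangle_free E (insert a S)"
  unfolding triangle_free_def
proof (intro ballI notI)
  fix u v w assume *: "u \<in> insert a S" "v \<in> insert a S" "w \<in> insert a S" "E u v \<and> E v w \<and> E w u"
  have "\<not> E v a" if "v \<in> insert a S" for v
    using that assms(2) E_asym irrefl by blast
  then have "u \<in> S" "v \<in> S" "w \<in> S" using * by blast+
  then show False using * assms(1) unfolding triangle_free_def by blast
qed

lemma pattern4_cases:
  assumes "p \<in> V" "q \<in> V" "r \<in> V" "s \<in> V" "distinct [p, q, r, s]"
  shows "\<exists>a b c d. {a, b, c, d} = {p, q, r, s} \<and>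
    (transitive4 E a b c d \<or> winner4 E a b c d \<or> winner4 (\<lambda>u v. E v u) a b c d \<or> strong4 E a b c d)"
proof -
  define Q where "Q a b c d \<longleftrightarrow> transitive4 E a b c d \<or> winner4 E a b c d
    \<or> winner4 (\<lambda>u v. E v u) a b c d \<or> strong4 E a b c d" for a b c d
  have sym: "E q p = (\<not> E p q)" "E r p = (\<not> E p r)" "E s p = (\<not> E p s)"
    "E r q = (\<not> E q r)" "E s q = (\<not> E q s)" "E s r = (\<not> E r s)"
    using assms E_asym E_total by auto
  \<comment> \<open>All 24 labellings. After \<open>sym\<close> six Boolean arcs remain, and in each
    of the 64 cases some labelling fits.\<close>
  have "Q p q r s \<or> Q p q s r \<or> Q p r q s \<or> Q p r s q \<or> Q p s q r \<or> Q p s r q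
    \<or> Q q p r s \<or> Q q p s r \<or> Q q r p s \<or> Q q r s p \<or> Q q s p r \<or> Q q s r p
    \<or> Q r p q s \<or> Q r p s q \<or> Q r q p s \<or> Q r q s p \<or> Q r s p q \<or> Q r s q p
    \<or> Q s p q r \<or> Q s p r q \<or> Q s q p r \<or> Q s q r p \<or> Q s r p q \<or> Q s r q p"
    unfolding Q_def pattern4_defs
    by (cases "E p q"; cases "E p r"; cases "E p s"; cases "E q r"; cases "E q s"; cases "E r s")
      (simp_all add: sym)
  then show ?thesis
    unfolding Q_def[symmetric]
    by (elim disjE; intro exI conjI; (assumption | (simp add: insert_commute)))
qed

text \<open>Induction on S: when u is added, either the old source a beats u and remains a source,
  or u beats a and hence, by transitivity, everything that a beats.\<close>

lemma triangle_free_source: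
  assumes "triangle_free E S" "S \<subseteq> V" "S \<noteq> {}"
  shows "\<exists>a\<in>S. \<forall>v\<in>S - {a}. E a v"
proof -
  have "finite S" using assms finite_V finite_subset by blast
  from this \<open>S \<noteq> {}\<close> show ?thesis
    using assms(1,2)
  proof (induction S rule: finite_ne_induct)
    case (insert u S)
    have "triangle_free E S" "S \<subseteq> V"
      using insert.prems unfolding triangle_free_def by blast+
    then obtain a where a: "a \<in> S" "\<forall>v\<in>S - {a}. E a v"
      using insert.IH by blast
    have "E u a \<or> E a u"
      using insert a E_total by (metis insert_iff subsetD)
    moreover have "\<forall>v\<in>S. E u v" if "E u a"
      using triangle_free_trans[OF insert.prems(1,2), of u a] a that by blast
    ultimately show ?case
      using a by auto
  qed simp_all
qed

end

definition is_max_weight :: "'a set \<Rightarrow> ('a \<Rightarrow> 'a \<Rightarrow> bool) \<Rightarrow> ('a \<Rightarrow> rat) \<Rightarrow> rat \<Rightarrow> bool" where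
  "is_max_weight V E x m \<longleftrightarrow>
     (\<exists>S \<subseteq> V. triangle_free E S \<and> sum x S = m) \<and>
     (\<forall>S \<subseteq> V. triangle_free E S \<longrightarrow> sum x S \<le> m)"

locale weighted_tournament_rel = tournament_rel +
  fixes x :: "'a \<Rightarrow> rat"
  assumes x_nonneg: "v \<in> V \<Longrightarrow> 0 \<le> x v"
begin

lemma sum_x_mono: "S \<subseteq> T \<Longrightarrow> T \<subseteq> V \<Longrightarrow> sum x S \<le> sum x T"
  using finite_V x_nonneg by (intro sum_mono2) (auto intro: finite_subset)

end

section \<open>Excluding the transitive tournament\<close>

context weighted_tournament_rel
begin

text \<open>A term is dropped when an arc it relies on is missing. So every triple, even with
  repetitions, yields the weight of some independent set, and the program may try all triples
  blindly.\<close>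

definition triple_weight :: "'a \<Rightarrow> 'a \<Rightarrow> 'a \<Rightarrow> rat" where
  "triple_weight a b c =
     x a + (if E a b then x b else 0) + (if E a c \<and> E b c then x c else 0)"

lemma triple_weight_attained:
  assumes "a \<in> V" "b \<in> V" "c \<in> V"
  shows "\<exists>S \<subseteq> V. triangle_free E S \<and> sum x S = triple_weight a b c"
proof -
  define S where "S = {a} \<union> (if E a b then {b} else {}) \<union> (if E a c \<and> E b c then {c} else {})"
  have "S \<subseteq> V" using assms by (auto simp: S_def)
  moreover have "triangle_free E S"
    unfolding S_def
    by (auto intro!: triangle_free_insert_source dest: E_asym
        simp: triangle_free_def insert_commute[of _ a] irrefl)
  moreover have "sum x S = triple_weight a b c"
    unfolding S_def triple_weight_def
    by (auto simp: insert_commute[of _ a] algebra_simps sum.insert_if irrefl dest: E_asym)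
  ultimately show ?thesis by blast
qed

text \<open>Splitting off a source up to three times exhausts S: a fourth vertex would complete
  \<open>transitive4\<close>.\<close>

lemma triangle_free_le_triple_weight:
  assumes no: "\<And>a b c d. \<not> transitive4 E a b c d"
    and S: "S \<subseteq> V" "triangle_free E S" "S \<noteq> {}"
  shows "\<exists>a\<in>V. \<exists>b\<in>V. \<exists>c\<in>V. sum x S \<le> triple_weight a b c"
proof -
  have source: "\<exists>a\<in>T. \<forall>v\<in>T - {a}. E a v" if "T \<subseteq> S" "T \<noteq> {}" for T
    using that S by (intro triangle_free_source) (unfold triangle_free_def, blast+)
  obtain a where a: "a \<in> S" "\<And>v. v \<in> S - {a} \<Longrightarrow> E a v"
    using source[of S] S by auto
  show ?thesis
  proof (cases "S - {a} = {}")
    case True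
    then have "S = {a}" using a by auto
    \<comment> \<open>Repeated entries encode smaller sets: as there are no loops, a repeated vertex
      is not counted again.\<close>
    then have "sum x S \<le> triple_weight a a a"
      by (simp add: triple_weight_def irrefl)
    then show ?thesis using a S by blast
  next
    case False
    then obtain b where b: "b \<in> S - {a}" "\<And>v. v \<in> S - {a} - {b} \<Longrightarrow> E b v"
      using source[of "S - {a}"] by auto
    show ?thesis
    proof (cases "S - {a} - {b} = {}")
      case True
      then have "S = {a, b}" "a \<noteq> b" "E a b" using a b by auto
      then have "sum x S \<le> triple_weight a b b"
        by (simp add: triple_weight_def irrefl)
      then show ?thesis using a b S by blast
    next
      case False
      then obtain c where c: "c \<in> S - {a} - {b}" "\<And>v. v \<in> S - {a} - {b} - {c} \<Longrightarrow> E c v"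
        using source[of "S - {a} - {b}"] by blast
      have "S = {a, b, c}"
      proof (rule ccontr)
        assume "S \<noteq> {a, b, c}"
        then obtain d where "d \<in> S - {a} - {b} - {c}" using a b c by auto
        then have "transitive4 E a b c d"
          unfolding transitive4_def using a b c by auto
        then show False using no by blast
      qed
      moreover have "distinct [a, b, c]" "E a b" "E a c" "E b c" using a b c by auto
      ultimately have "sum x S \<le> triple_weight a b c"
        by (simp add: triple_weight_def)
      then show ?thesis using a b c S by blast
    qed
  qed
qed

end

section \<open>Excluding a vertex dominating a cyclic triangle\<close>

context weighted_tournament_rel
begin

definition out_weight :: "'a \<Rightarrow> rat" where
  "out_weight a = x a + (\<Sum>v\<in>V. if E a v then x v else 0)"

lemma out_weight_eq: "out_weight a = sum x (insert a {v \<in> V. E a v})"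
  using finite_V by (simp add: out_weight_def irrefl sum.inter_filter)

text \<open>A cyclic triangle among the out-neighbours of a would form \<open>winner4\<close>
  together with a, and a itself is a source.\<close>

lemma out_weight_attained:
  assumes no: "\<And>a b c d. \<not> winner4 E a b c d" and "a \<in> V"
  shows "\<exists>S \<subseteq> V. triangle_free E S \<and> sum x S = out_weight a"
proof (intro exI conjI)
  show "insert a {v \<in> V. E a v} \<subseteq> V" using assms by auto
  show "triangle_free E (insert a {v \<in> V. E a v})"
  proof (rule triangle_free_insert_source)
    show "triangle_free E {v \<in> V. E a v}"
      using no[of a] unfolding triangle_free_def winner4_def by blast
  qed simp
qed (simp add: out_weight_eq)

text \<open>S consists of its source and some out-neighbours of it; since weights are nonnegative,
  adding the remaining out-neighbours does not decrease the sum.\<close>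

lemma triangle_free_le_out_weight:
  assumes "S \<subseteq> V" "triangle_free E S" "S \<noteq> {}"
  shows "\<exists>a\<in>V. sum x S \<le> out_weight a"
proof -
  obtain a where a: "a \<in> S" "\<And>v. v \<in> S - {a} \<Longrightarrow> E a v"
    using triangle_free_source[OF assms(2,1,3)] by blast
  have "sum x S \<le> out_weight a"
    unfolding out_weight_eq using assms a by (intro sum_x_mono) auto
  then show ?thesis using a assms by blast
qed

end

section \<open>Excluding the strong tournament\<close>

locale strong4_free_rel = weighted_tournament_rel V E x
  for V :: "'a :: linorder set" and E x +
  assumes no_strong4: "\<not> strong4 E a b c d"
begin

text \<open>If d had arcs both to and from the triangle, the four vertices would be strongly
  connected.\<close>

lemma triangle_module:
  assumes "E a b" "E b c" "E c a" "d \<in> V" "d \<notin> {a, b, c}"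
  shows "(E d a \<and> E d b \<and> E d c) \<or> (E a d \<and> E b d \<and> E c d)"
proof -
  have "E d a = (\<not> E a d)" "E d b = (\<not> E b d)" "E d c = (\<not> E c d)"
    using assms E_asym E_total E_in_V by blast+
  \<comment> \<open>If d beats only a, the forbidden labelling is b, c, d, a; if d loses only to c,
    it is c, d, a, b. The other mixed cases are rotations of these two.\<close>
  then show ?thesis
    using assms(1-3) no_strong4[of d a b c] no_strong4[of d b c a] no_strong4[of d c a b]
      no_strong4[of a b c d] no_strong4[of b c a d] no_strong4[of c a b d]
      no_strong4[of a d b c] no_strong4[of b d c a] no_strong4[of c d a b]
      no_strong4[of a b d c] no_strong4[of b c d a] no_strong4[of c a d b]
    unfolding strong4_def by argo
qed

text \<open>The order on vertices singles out the rotation that starts at the smallest vertex, so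
  each cyclic triangle is counted once.\<close>

definition triangles :: "('a \<times> 'a \<times> 'a) set" where
  "triangles = {(a, b, c). E a b \<and> E b c \<and> E c a \<and> a < b \<and> a < c}"

definition triangle_min :: "'a \<Rightarrow> 'a \<Rightarrow> 'a \<Rightarrow> rat" where
  "triangle_min a b c = min (min (x a) (x b)) (x c)"

fun corners :: "'a \<times> 'a \<times> 'a \<Rightarrow> 'a set" where
  "corners (a, b, c) = {a, b, c}"

text \<open>Suppose b' lies outside the first triangle. By \<open>triangle_module\<close>, b' is
  dominated by b as it is by a; but b then lies outside the second triangle and is dominated by b'
  as it is by a, a contradiction. The argument for c' is the same with arcs reversed.\<close>

lemma triangles_meet:
  assumes "E a b" "E b c" "E c a" "E a b'" "E b' c'" "E c' a"
  shows "b' = b \<and> c' = c"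
proof -
  have V: "a \<in> V" "b \<in> V" "c \<in> V" "b' \<in> V" "c' \<in> V" using assms E_in_V by blast+
  show ?thesis
    using triangle_module[OF assms(1-3) V(4)] triangle_module[OF assms(1-3) V(5)]
      triangle_module[OF assms(4-6) V(2)] triangle_module[OF assms(4-6) V(3)]
      assms E_asym irrefl by blast
qed

text \<open>Rotating both triangles to start at v reduces this to \<open>triangles_meet\<close>; the
  smallest-first convention then makes the triples equal.\<close>

lemma triangles_disjoint:
  assumes "t \<in> triangles" "t' \<in> triangles" "v \<in> corners t" "v \<in> corners t'"
  shows "t = t'"
proof -
  obtain a b c a' b' c' where t: "t = (a, b, c)" "t' = (a', b', c')"
    by (metis prod_cases3)
  have "E a b" "E b c" "E c a" "a < b" "a < c" "E a' b'" "E b' c'" "E c' a'" "a' < b'" "a' < c'"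
    "v = a \<or> v = b \<or> v = c" "v = a' \<or> v = b' \<or> v = c'"
    using assms t by (auto simp: triangles_def)
  then show ?thesis
    unfolding t by (metis less_asym triangles_meet)
qed

lemma finite_triangles: "finite triangles"
  by (rule finite_subset[of _ "V \<times> V \<times> V"]) (use finite_V E_in_V in \<open>auto simp: triangles_def\<close>)

lemma corners_subset: "t \<in> triangles \<Longrightarrow> corners t \<subseteq> V"
  using E_in_V by (auto simp: triangles_def)

lemma triangle_has_canonical_rotation:
  assumes "E a b" "E b c" "E c a"
  shows "\<exists>t\<in>triangles. corners t = {a, b, c}"
proof -
  have ne: "a \<noteq> b" "b \<noteq> c" "c \<noteq> a" using assms irrefl by auto
  consider "a < b" "a < c" | "b < c" "b < a" | "c < a" "c < b"
    using ne by (metis less_linear less_trans)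
  then show ?thesis
  proof cases
    case 1 then show ?thesis using assms by (intro bexI[of _ "(a, b, c)"]) (auto simp: triangles_def)
  next
    case 2 then show ?thesis using assms by (intro bexI[of _ "(b, c, a)"]) (auto simp: triangles_def)
  next
    case 3 then show ?thesis using assms by (intro bexI[of _ "(c, a, b)"]) (auto simp: triangles_def)
  qed
qed

text \<open>Disjointness makes a choice of corners injective.\<close>

lemma sum_choice:
  assumes "\<And>t. t \<in> triangles \<Longrightarrow> f t \<in> corners t"
  shows "sum x (f ` triangles) = (\<Sum>t\<in>triangles. x (f t))"
proof -
  have "inj_on f triangles"
    using assms triangles_disjoint by (intro inj_onI) metis
  then show ?thesis by (simp add: sum.reindex)
qed

text \<open>Deleting a lightest corner of each cyclic triangle attains the value. Conversely, an
  independent set misses a corner of every triangle; these corners are distinct, so its complement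
  weighs at least the sum of the minima.\<close>

lemma is_max_weight_triangles:
  "is_max_weight V E x (sum x V - (\<Sum>(a, b, c)\<in>triangles. triangle_min a b c))"
  unfolding is_max_weight_def
proof (intro conjI allI impI)
  let ?m = "\<lambda>t. case t of (a, b, c) \<Rightarrow> triangle_min a b c"
  have ex: "\<exists>v\<in>corners t. x v = ?m t" for t
    by (cases t) (auto simp: triangle_min_def min_def)
  then obtain f where f: "\<And>t. f t \<in> corners t" "\<And>t. x (f t) = ?m t" by metis
  have "f ` triangles \<subseteq> V" using f(1) corners_subset by blast
  then have "sum x (V - f ` triangles) = sum x V - sum ?m triangles"
    using finite_V finite_triangles f by (simp add: sum_diff sum_choice)
  moreover have "triangle_free E (V - f ` triangles)"
    unfolding triangle_free_def
  proof (intro ballI notI)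
    fix a b c
    assume "a \<in> V - f ` triangles" "b \<in> V - f ` triangles" "c \<in> V - f ` triangles"
      "E a b \<and> E b c \<and> E c a"
    moreover from this obtain t where "t \<in> triangles" "corners t = {a, b, c}"
      using triangle_has_canonical_rotation by blast
    ultimately show False using f(1)[of t] by auto
  qed
  ultimately show "\<exists>S\<subseteq>V. triangle_free E S \<and> sum x S = sum x V - sum ?m triangles" by blast
next
  let ?m = "\<lambda>t. case t of (a, b, c) \<Rightarrow> triangle_min a b c"
  fix S assume S: "S \<subseteq> V" "triangle_free E S"
  have "\<exists>v\<in>corners t. v \<notin> S" if "t \<in> triangles" for t
    using that S(2) by (cases t) (auto simp: triangles_def triangle_free_def)
  then obtain f where f: "\<And>t. t \<in> triangles \<Longrightarrow> f t \<in> corners t" "\<And>t. t \<in> triangles \<Longrightarrow> f t \<notin> S"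
    by metis
  have "?m t \<le> x v" if "v \<in> corners t" for t v
    using that by (cases t) (auto simp: triangle_min_def)
  then have "sum ?m triangles \<le> (\<Sum>t\<in>triangles. x (f t))"
    by (intro sum_mono) (use f in blast)
  also have "\<dots> = sum x (f ` triangles)" by (simp add: sum_choice f)
  also have "\<dots> \<le> sum x (V - S)"
    by (intro sum_x_mono) (use f corners_subset in blast)+
  also have "\<dots> = sum x V - sum x S"
    using S finite_V by (simp add: sum_diff)
  finally show "sum x S \<le> sum x V - sum ?m triangles" by simp
qed

text \<open>The same optimum, arranged in the order in which the nested loops of
  \<open>triangle_program\<close> accumulate it.\<close>

lemma is_max_weight_triangle_sums:
  "is_max_weight V E x (\<Sum>a\<in>V. x a - (\<Sum>b\<in>V. \<Sum>c\<in>V.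
     if E a b \<and> E b c \<and> E c a \<and> a < b \<and> a < c then triangle_min a b c else 0))"
proof -
  let ?g = "\<lambda>a b c. if E a b \<and> E b c \<and> E c a \<and> a < b \<and> a < c then triangle_min a b c else 0"
  have "(\<Sum>(a, b, c)\<in>triangles. triangle_min a b c)
      = (\<Sum>t\<in>V \<times> V \<times> V. case t of (a, b, c) \<Rightarrow> ?g a b c)"
    using finite_V E_in_V
    by (intro sum.mono_neutral_cong_left) (auto simp: triangles_def split: if_splits)
  then have "(\<Sum>(a, b, c)\<in>triangles. triangle_min a b c) = (\<Sum>a\<in>V. \<Sum>b\<in>V. \<Sum>c\<in>V. ?g a b c)"
    by (simp add: sum.cartesian_product)
  then show ?thesis
    using is_max_weight_triangles by (simp add: sum_subtractf)
qed

end

section \<open>Tournaments as digraphs\<close>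

lemma (in tournament) tournament_rel: "tournament_rel (verts G) (\<lambda>u v. u \<rightarrow>\<^bsub>G\<^esub> v)"
proof
  show "\<not> v \<rightarrow>\<^bsub>G\<^esub> u" if "u \<rightarrow>\<^bsub>G\<^esub> v" for u v
    using that exactly_one_arc[of u v] no_loops by (cases "u = v") (force simp: arcs_ends_conv)+
  show "u \<rightarrow>\<^bsub>G\<^esub> v \<or> v \<rightarrow>\<^bsub>G\<^esub> u" if "u \<in> verts G" "v \<in> verts G" "u \<noteq> v" for u v
    using exactly_one_arc[OF that] by blast
qed (auto simp: arcs_ends_conv)

text \<open>Between tournaments a map that preserves arcs is already an induced embedding: totality
  of H yields injectivity and, with asymmetry of G, reflection of arcs.\<close>

lemma not_free_of_embedding:
  assumes "tournament H" "tournament G"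
    and f: "f ` verts H \<subseteq> verts G" "\<And>u v. u \<rightarrow>\<^bsub>H\<^esub> v \<Longrightarrow> f u \<rightarrow>\<^bsub>G\<^esub> f v"
  shows "\<not> free_of H G"
proof -
  interpret H: tournament H by fact
  interpret G: tournament G by fact
  interpret RH: tournament_rel "verts H" "\<lambda>u v. u \<rightarrow>\<^bsub>H\<^esub> v" by (rule H.tournament_rel)
  interpret RG: tournament_rel "verts G" "\<lambda>u v. u \<rightarrow>\<^bsub>G\<^esub> v" by (rule G.tournament_rel)
  \<comment> \<open>Distinct vertices of H are joined by an arc, whose image would be a loop if f
    identified them.\<close>
  have inj: "inj_on f (verts H)"
    using f(2) RH.E_total RG.irrefl by (intro inj_onI) metis
  define G' where "G' = G \<restriction> (f ` verts H)"
  have "\<forall>a\<in>arcs H. \<exists>e\<in>arcs G. tail G e = f (tail H a) \<and> head G e = f (head H a)"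
  proof
    fix a assume "a \<in> arcs H"
    then have "f (tail H a) \<rightarrow>\<^bsub>G\<^esub> f (head H a)" by (intro f(2)) (auto simp: arcs_ends_conv)
    then show "\<exists>e\<in>arcs G. tail G e = f (tail H a) \<and> head G e = f (head H a)"
      by (auto simp: arcs_ends_conv)
  qed
  then obtain g where g: "\<And>a. a \<in> arcs H \<Longrightarrow> g a \<in> arcs G"
    "\<And>a. a \<in> arcs H \<Longrightarrow> tail G (g a) = f (tail H a)"
    "\<And>a. a \<in> arcs H \<Longrightarrow> head G (g a) = f (head H a)"
    by metis
  \<comment> \<open>Taking \<open>head G\<close> and \<open>tail G\<close> here makes
    \<open>app_iso h H\<close> equal to G', not merely isomorphic to it.\<close>
  define h where "h = \<lparr>iso_verts = f, iso_arcs = g, iso_head = head G, iso_tail = tail G\<rparr>"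
  have "inj_on g (arcs H)"
  proof (rule inj_onI)
    fix a b assume ab: "a \<in> arcs H" "b \<in> arcs H" "g a = g b"
    then have "f (tail H a) = f (tail H b)" "f (head H a) = f (head H b)" using g by metis+
    then have "arc_to_ends H a = arc_to_ends H b"
      using ab inj by (auto simp: arc_to_ends_def inj_on_eq_iff)
    then show "a = b" using ab H.no_multi_arcs by blast
  qed
  then have "H.digraph_isomorphism h"
    unfolding H.digraph_isomorphism_def using inj g H.wf_digraph by (simp add: h_def)
  moreover have "app_iso h H = G'"
  proof -
    \<comment> \<open>The vertices u and v are joined in H; an arc from v to u would map to the
      reverse of e. Without parallel arcs, e is the image of the arc from u to v.\<close>
    have "e \<in> g ` arcs H" if e: "e \<in> arcs G" "tail G e \<in> f ` verts H" "head G e \<in> f ` verts H" for e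
    proof -
      obtain u v where uv: "u \<in> verts H" "v \<in> verts H" "tail G e = f u" "head G e = f v"
        using e by auto
      have arc: "f u \<rightarrow>\<^bsub>G\<^esub> f v" using e(1) uv by (force simp: arcs_ends_conv)
      then have "u \<rightarrow>\<^bsub>H\<^esub> v"
        using RH.E_total[OF uv(1,2)] f(2) RG.E_asym by metis
      then obtain a where a: "a \<in> arcs H" "tail H a = u" "head H a = v"
        by (auto simp: arcs_ends_conv)
      then have "arc_to_ends G (g a) = arc_to_ends G e"
        using g uv by (simp add: arc_to_ends_def)
      then show ?thesis using a g e G.no_multi_arcs by blast
    qed
    then have "g ` arcs H = {e \<in> arcs G. tail G e \<in> f ` verts H \<and> head G e \<in> f ` verts H}"
      using g by auto
    then show ?thesis by (simp add: app_iso_def h_def G'_def induce_subgraph_def)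
  qed
  ultimately have "digraph_iso H G'" unfolding digraph_iso_def by metis
  then have "digraph_iso G' H" using H.wf_digraph digraph_iso_swap by blast
  moreover have "induced_subgraph G' G" unfolding G'_def using f(1) by (rule G.induced_induce)
  ultimately show ?thesis unfolding free_of_def by blast
qed

lemma not_free_of_pattern4:
  fixes H :: "('a, 'b) pre_digraph" and G :: "('c, 'd) pre_digraph"
  defines "E \<equiv> (\<lambda>u v. u \<rightarrow>\<^bsub>H\<^esub> v)" and "F \<equiv> (\<lambda>u v. u \<rightarrow>\<^bsub>G\<^esub> v)"
  assumes "tournament H" "tournament G" "verts H = {p, q, r, s}"
    and pat: "transitive4 E p q r s \<and> transitive4 F a b c d
      \<or> winner4 E p q r s \<and> winner4 F a b c d
      \<or> winner4 (\<lambda>u v. E v u) p q r s \<and> winner4 (\<lambda>u v. F v u) a b c d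
      \<or> strong4 E p q r s \<and> strong4 F a b c d"
  shows "\<not> free_of H G"
proof -
  interpret RH: tournament_rel "verts H" E unfolding E_def by (rule tournament.tournament_rel) fact
  interpret RG: tournament_rel "verts G" F unfolding F_def by (rule tournament.tournament_rel) fact
  have ne: "p \<noteq> q" "p \<noteq> r" "p \<noteq> s" "q \<noteq> r" "q \<noteq> s" "r \<noteq> s"
    using pat RH.irrefl unfolding pattern4_defs by blast+
  have "a \<in> verts G" "b \<in> verts G" "c \<in> verts G" "d \<in> verts G"
    using pat RG.E_in_V unfolding pattern4_defs by blast+
  have asym: "E q p = (\<not> E p q)" "E r p = (\<not> E p r)" "E s p = (\<not> E p s)"
    "E r q = (\<not> E q r)" "E s q = (\<not> E q s)" "E s r = (\<not> E r s)"
    using ne RH.E_asym RH.E_total assms(5) by auto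
  \<comment> \<open>The fourth vertex s receives the default value d.\<close>
  define f where "f = (\<lambda>v. d)(p := a, q := b, r := c)"
  have f: "f p = a" "f q = b" "f r = c" "f s = d"
    using ne by (auto simp: f_def)
  have "F (f u) (f v)" if "E u v" for u v
  proof -
    have "u = p \<or> u = q \<or> u = r \<or> u = s" "v = p \<or> v = q \<or> v = r \<or> v = s"
      using RH.E_in_V[OF that] assms(5) by auto
    then show ?thesis
      using pat that unfolding pattern4_defs
      by (elim disjE) (auto simp: f asym RH.irrefl)
  qed
  moreover have "f ` verts H \<subseteq> verts G"
    unfolding assms(5) using f \<open>a \<in> _\<close> \<open>b \<in> _\<close> \<open>c \<in> _\<close> \<open>d \<in> _\<close> by auto
  ultimately show ?thesis
    using not_free_of_embedding[OF assms(3,4)] unfolding E_def F_def by blast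
qed

text \<open>Without cyclic triangles the arc relation on X is transitive, so a nonempty walk shrinks
  to a single arc from start to end, and a cycle would give a loop. Conversely, a cyclic triangle is
  a cycle.\<close>

lemma independent_iff_triangle_free:
  assumes "tournament G"
  shows "independent G X \<longleftrightarrow> X \<subseteq> verts G \<and> triangle_free (\<lambda>u v. u \<rightarrow>\<^bsub>G\<^esub> v) X"
proof -
  interpret G: tournament G by fact
  interpret R: tournament_rel "verts G" "\<lambda>u v. u \<rightarrow>\<^bsub>G\<^esub> v" by (rule G.tournament_rel)
  interpret X: wf_digraph "G \<restriction> X" by (rule G.wellformed_induce_subgraph)
  have arc: "u \<rightarrow>\<^bsub>G\<^esub> v \<longleftrightarrow> (\<exists>e\<in>arcs (G \<restriction> X). tail G e = u \<and> head G e = v)"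
    if "u \<in> X" "v \<in> X" for u v
    using that by (auto simp: arcs_ends_conv)
  have "triangle_free (\<lambda>u v. u \<rightarrow>\<^bsub>G\<^esub> v) X \<longleftrightarrow> \<not> (\<exists>p. X.cycle p)" if "X \<subseteq> verts G"
  proof
    assume tf: "triangle_free (\<lambda>u v. u \<rightarrow>\<^bsub>G\<^esub> v) X"
    have walk: "u \<rightarrow>\<^bsub>G\<^esub> v" if "X.awalk u p v" "p \<noteq> []" for u p v
      using that
    proof (induction p arbitrary: u)
      case (Cons e p)
      then have e: "e \<in> arcs (G \<restriction> X)" "tail G e = u" "X.awalk (head G e) p v"
        by (auto simp: X.awalk_Cons_iff)
      have uX: "u \<in> X" "head G e \<in> X" "v \<in> X"
        using e X.awalk_last_in_verts[OF e(3)] by auto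
      have step: "u \<rightarrow>\<^bsub>G\<^esub> head G e" using e arc[OF uX(1,2)] by blast
      show ?case
      proof (cases "p = []")
        case True
        then show ?thesis using step e(3) by (simp add: X.awalk_def)
      next
        case False
        then have "head G e \<rightarrow>\<^bsub>G\<^esub> v" using Cons.IH e(3) by blast
        then show ?thesis
          using R.triangle_free_trans[OF tf \<open>X \<subseteq> verts G\<close> uX step] by blast
      qed
    qed simp
    show "\<not> (\<exists>p. X.cycle p)"
      unfolding X.cycle_def using walk R.irrefl by blast
  next
    assume no: "\<not> (\<exists>p. X.cycle p)"
    show "triangle_free (\<lambda>u v. u \<rightarrow>\<^bsub>G\<^esub> v) X"
      unfolding triangle_free_def
    proof (intro ballI notI)
      fix a b c assume abc: "a \<in> X" "b \<in> X" "c \<in> X" "a \<rightarrow>\<^bsub>G\<^esub> b \<and> b \<rightarrow>\<^bsub>G\<^esub> c \<and> c \<rightarrow>\<^bsub>G\<^esub> a"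
      obtain e f g where "e \<in> arcs (G \<restriction> X)" "f \<in> arcs (G \<restriction> X)" "g \<in> arcs (G \<restriction> X)"
        "tail G e = a" "head G e = b" "tail G f = b" "head G f = c" "tail G g = c" "head G g = a"
        using abc arc by metis
      moreover have "a \<noteq> b" "b \<noteq> c" "c \<noteq> a" using abc R.irrefl by auto
      ultimately have "X.cycle [e, f, g]"
        unfolding X.cycle_def X.awalk_def using abc(1) by (intro exI[of _ a]) auto
      then show False using no by blast
    qed
  qed
  then show ?thesis
    unfolding independent_def transitive_def by blast
qed

text \<open>Programs see vertices only as positions in \<open>vs\<close>. As \<open>vs\<close> is
  distinct, indexing is a bijection that carries independent sets and their weights over.\<close>

lemma max_independent_weight_eqI:
  assumes "tournament G" "distinct vs" "set vs = verts G"
    and max: "is_max_weight {..<length vs}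
      (\<lambda>i j. i < length vs \<and> j < length vs \<and> vs ! i \<rightarrow>\<^bsub>G\<^esub> vs ! j) (\<lambda>i. w (vs ! i)) m"
  shows "max_independent_weight G w = m"
proof -
  interpret G: tournament G by fact
  let ?n = "length vs"
  let ?E = "\<lambda>i j. i < ?n \<and> j < ?n \<and> vs ! i \<rightarrow>\<^bsub>G\<^esub> vs ! j"
  have inj: "inj_on ((!) vs) {..<?n}" using assms(2) by (simp add: inj_on_nth)
  have img: "(!) vs ` {..<?n} = verts G" using assms(3) by (auto simp: set_conv_nth)
  have ind: "independent G ((!) vs ` S) \<longleftrightarrow> triangle_free ?E S" if "S \<subseteq> {..<?n}" for S
    using that img unfolding independent_iff_triangle_free[OF assms(1)] triangle_free_def by blast
  have sum: "sum w ((!) vs ` S) = (\<Sum>i\<in>S. w (vs ! i))" if "S \<subseteq> {..<?n}" for S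
    using inj_on_subset[OF inj that] by (simp add: sum.reindex)
  have all: "\<exists>S\<subseteq>{..<?n}. X = (!) vs ` S" if "independent G X" for X
    using that img unfolding independent_def by (metis subset_image_iff)
  have "{(\<Sum>v\<in>S. w v) | S. independent G S} \<subseteq> sum w ` Pow (verts G)"
    by (auto simp: independent_def)
  then have "finite {(\<Sum>v\<in>S. w v) | S. independent G S}"
    by (rule finite_subset) simp
  then show ?thesis
    unfolding max_independent_weight_def
  proof (rule Max_eqI)
    show "y \<le> m" if "y \<in> {(\<Sum>v\<in>S. w v) | S. independent G S}" for y
    proof -
      from that obtain X where X: "independent G X" "y = sum w X" by blast
      with all obtain S where S: "S \<subseteq> {..<?n}" "X = (!) vs ` S" by blast
      then show ?thesis using max X ind sum unfolding is_max_weight_def by auto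
    qed
    obtain S where S: "S \<subseteq> {..<?n}" "triangle_free ?E S" "(\<Sum>i\<in>S. w (vs ! i)) = m"
      using max unfolding is_max_weight_def by blast
    have "independent G ((!) vs ` S)" "m = sum w ((!) vs ` S)"
      using ind[OF S(1)] sum[OF S(1)] S(2,3) by simp_all
    then show "m \<in> {(\<Sum>v\<in>S. w v) | S. independent G S}"
      by blast
  qed
qed

section \<open>Verification of timed programs\<close>

text \<open>Total correctness with an upper bound on the time, so that branches of different length
  share one bound.\<close>

definition runs :: "program \<Rightarrow> ram_state \<Rightarrow> nat \<Rightarrow> (ram_state \<Rightarrow> bool) \<Rightarrow> bool" where
  "runs c s T Q \<longleftrightarrow> (\<exists>t s'. exec c s t s' \<and> t \<le> T \<and> Q s')"

lemma runs_mono: "runs c s T P \<Longrightarrow> T \<le> U \<Longrightarrow> (\<And>s'. P s' \<Longrightarrow> Q s') \<Longrightarrow> runs c s U Q"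
  unfolding runs_def by (meson order_trans)

lemma runs_Seq: "runs c s T (\<lambda>s'. runs d s' U Q) \<Longrightarrow> runs (Seq c d) s (T + U) Q"
  unfolding runs_def by (meson add_mono exec.Seq)

section \<open>Symbolic execution of loop-free programs\<close>

fun loop_free :: "program \<Rightarrow> bool" where
  "loop_free Skip \<longleftrightarrow> True"
| "loop_free (Instr i) \<longleftrightarrow> True"
| "loop_free (Seq c d) \<longleftrightarrow> loop_free c \<and> loop_free d"
| "loop_free (Cond b c d) \<longleftrightarrow> loop_free c \<and> loop_free d"
| "loop_free (While b c) \<longleftrightarrow> False"

fun run :: "program \<Rightarrow> ram_state \<Rightarrow> ram_state" where
  "run Skip s = s"
| "run (Instr i) s = instr_step i s"
| "run (Seq c d) s = run d (run c s)"
| "run (Cond b c d) s = (if test_holds b s then run c s else run d s)"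
| "run (While b c) s = s"

fun cost :: "program \<Rightarrow> nat" where
  "cost Skip = 1"
| "cost (Instr i) = 1"
| "cost (Seq c d) = cost c + cost d"
| "cost (Cond b c d) = 1 + max (cost c) (cost d)"
| "cost (While b c) = 0"

text \<open>Reduces a loop body to evaluating \<open>run\<close> and \<open>cost\<close>, which
  simplification can do.\<close>

lemma runs_loop_freeI:
  assumes "loop_free c" "cost c \<le> T" "Q (run c s)"
  shows "runs c s T Q"
proof -
  have "\<exists>t\<le>cost c. exec c s t (run c s)"
    using assms(1)
  proof (induction c arbitrary: s)
    case (Seq c d)
    then obtain t u where "t \<le> cost c" "exec c s t (run c s)"
      "u \<le> cost d" "exec d (run c s) u (run d (run c s))"
      by fastforce
    then show ?case by (auto intro!: exI[of _ "t + u"] exec.Seq)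
  next
    case (Cond b c d)
    then obtain t u where "t \<le> cost c" "exec c s t (run c s)" "u \<le> cost d" "exec d s u (run d s)"
      by fastforce
    then have "test_holds b s \<Longrightarrow> exec (Cond b c d) s (1 + t) (run c s)"
      "\<not> test_holds b s \<Longrightarrow> exec (Cond b c d) s (1 + u) (run d s)"
      by (simp_all only: exec.CondTrue exec.CondFalse not_False_eq_True)
    moreover have "1 + t \<le> cost (Cond b c d)" "1 + u \<le> cost (Cond b c d)"
      using \<open>t \<le> cost c\<close> \<open>u \<le> cost d\<close> by auto
    ultimately show ?case
      unfolding run.simps by metis
  next
    case Skip
    show ?case using exec.Skip by auto
  next
    case (Instr i)
    show ?case using exec.Instr by auto
  qed simp
  then show ?thesis using assms(2,3) unfolding runs_def by (meson order_trans)
qed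

text \<open>
  Integer register 0 holds the number \<open>n\<close> of vertices and register 1 the constant 1. The loop
  counter \<open>i\<close> comes with a register \<open>b\<close> that holds the product of \<open>i\<close> and \<open>n\<close>, which is the
  address of row \<open>i\<close> of the adjacency matrix; the machine cannot multiply.
\<close>

definition For :: "nat \<Rightarrow> nat \<Rightarrow> program \<Rightarrow> program" where
  "For i b c = Seq (Instr (IConst i 0)) (Seq (Instr (IConst b 0))
     (While (ILess i 0) (Seq c (Seq (Instr (IAdd i i 1)) (Instr (IAdd b b 0))))))"

text \<open>The assumption \<open>frame\<close> says that the invariant ignores the two loop
  registers, so it survives their initialization and increments.\<close>

lemma runs_For:
  fixes I :: "nat \<Rightarrow> ram_state \<Rightarrow> bool"
  assumes regs: "i \<notin> {0, 1}" "b \<notin> {0, 1}" "i \<noteq> b"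
    and body: "\<And>k s. \<lbrakk>k < n; I k s; ireg s i = k; ireg s b = k * n\<rbrakk> \<Longrightarrow>
      runs c s T (\<lambda>s'. I (Suc k) s' \<and> ireg s' i = k \<and> ireg s' b = k * n)"
    and const_regs: "\<And>k s. I k s \<Longrightarrow> ireg s 0 = n \<and> ireg s 1 = 1"
    and frame: "\<And>k s u v. I k s \<Longrightarrow> I k (s\<lparr>ireg := (ireg s)(i := u, b := v)\<rparr>)"
    and init: "I 0 s"
  shows "runs (For i b c) s (3 + n * (T + 3)) (I n)"
proof -
  let ?step = "Seq (Instr (IAdd i i 1)) (Instr (IAdd b b 0))"
  \<comment> \<open>Induction from k = n downwards. An iteration costs one test, at most T for the
    body and two additions; the failing test at the end costs 1.\<close>
  have loop: "runs (While (ILess i 0) (Seq c ?step)) s (1 + (n - k) * (T + 3)) (I n)"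
    if "k \<le> n" "I k s" "ireg s i = k" "ireg s b = k * n" for k s
    using that
  proof (induction k arbitrary: s rule: inc_induct)
    case base
    then have "\<not> test_holds (ILess i 0) s" using const_regs by auto
    from exec.WhileFalse[OF this] show ?case
      using base unfolding runs_def by fastforce
  next
    case (step k)
    obtain t s' where s': "exec c s t s'" "t \<le> T" "I (Suc k) s'" "ireg s' i = k" "ireg s' b = k * n"
      using body[OF \<open>k < n\<close> step.prems] unfolding runs_def by blast
    define s'' where "s'' = s'\<lparr>ireg := (ireg s')(i := Suc k, b := Suc k * n)\<rparr>"
    have "run ?step s' = s''"
      using s'(4,5) const_regs[OF s'(3)] regs by (simp add: s''_def add.commute)
    moreover have "exec ?step s' (1 + 1) (run ?step s')"
      unfolding run.simps by (rule exec.Seq[OF exec.Instr exec.Instr])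
    ultimately have *: "exec (Seq c ?step) s (t + (1 + 1)) s''"
      using s'(1) by (metis exec.Seq)
    have "runs (While (ILess i 0) (Seq c ?step)) s'' (1 + (n - Suc k) * (T + 3)) (I n)"
      using frame[OF s'(3)] regs by (intro step.IH) (auto simp: s''_def)
    then obtain u r where u: "exec (While (ILess i 0) (Seq c ?step)) s'' u r"
      "u \<le> 1 + (n - Suc k) * (T + 3)" "I n r"
      unfolding runs_def by blast
    have "test_holds (ILess i 0) s" using step.prems step.hyps const_regs by auto
    from exec.WhileTrue[OF this * u(1)] have
      "exec (While (ILess i 0) (Seq c ?step)) s (1 + (t + (1 + 1)) + u) r" .
    moreover have "n - k = Suc (n - Suc k)" using step.hyps by simp
    then have "1 + (t + (1 + 1)) + u \<le> 1 + (n - k) * (T + 3)"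
      using u(2) s'(2) by simp
    ultimately show ?case using u(3) unfolding runs_def by blast
  qed
  define s0 where "s0 = s\<lparr>ireg := (ireg s)(i := 0, b := 0)\<rparr>"
  have "runs (While (ILess i 0) (Seq c ?step)) s0 (1 + (n - 0) * (T + 3)) (I n)"
    using frame[OF init] regs by (intro loop) (auto simp: s0_def)
  then obtain t r where t: "exec (While (ILess i 0) (Seq c ?step)) s0 t r"
    "t \<le> 1 + n * (T + 3)" "I n r"
    unfolding runs_def by auto
  have s0: "instr_step (IConst b 0) (instr_step (IConst i 0) s) = s0" by (simp add: s0_def)
  have "exec (For i b c) s (1 + (1 + t)) r"
    unfolding For_def
    by (rule exec.Seq[OF exec.Instr exec.Seq[OF exec.Instr]]) (use t(1) in \<open>simp only: s0\<close>)
  then show ?thesis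
    using t(2,3) unfolding runs_def by fastforce
qed

text \<open>Integer register 9 and rational register 9 are never written, so they hold 0.\<close>

definition If_arc :: "nat \<Rightarrow> nat \<Rightarrow> program \<Rightarrow> program" where
  "If_arc b j c = Seq (Instr (IAdd 10 b j)) (Seq (Instr (ILoad 10 10)) (Cond (ILess 9 10) c Skip))"

text \<open>Adding the zero register 9 replaces a copy instruction.\<close>

definition maximum_step :: program where
  "maximum_step = Cond (QLess 0 1) (Instr (QAdd 0 1 9)) Skip"

text \<open>The part of the state that the loops below preserve; it belongs to each of their
  invariants.\<close>

definition encodes ::
  "nat \<Rightarrow> (nat \<Rightarrow> nat \<Rightarrow> bool) \<Rightarrow> (nat \<Rightarrow> rat) \<Rightarrow> ram_state \<Rightarrow> bool" where
  "encodes n E x s \<longleftrightarrow> ireg s 0 = n \<and> ireg s 1 = 1 \<and> ireg s 9 = 0 \<and> qreg s 9 = 0 \<and>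
     (\<forall>i<n. \<forall>j<n. imem s (i * n + j) = (if E i j then 1 else 0)) \<and> (\<forall>i<n. qmem s i = x i)"

section \<open>The programs\<close>

text \<open>
  The register pairs (3, 4), (5, 6) and (7, 8) are the loop counters and their row addresses.
  Rational register 0 accumulates the result, register 1 holds the current candidate.
\<close>

lemma Max_insert_second:
  "finite B \<Longrightarrow> Max (insert z (insert y B)) = max (Max (insert z B)) y"
  by (subst insert_commute) (subst Max_insert, auto simp: max.commute)

section \<open>Maximum weight of a vertex with its out-neighbours\<close>

definition out_program :: "bool \<Rightarrow> program" where
  "out_program t = For 3 4 (Seq (Instr (QLoad 1 3)) (Seq
     (For 5 6 (If_arc (if t then 6 else 4) (if t then 3 else 5)
        (Seq (Instr (QLoad 2 5)) (Instr (QAdd 1 1 2)))))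
     maximum_step))"

text \<open>If t holds, the address read is j * n + i instead of i * n + j, so the same program
  treats the reversed tournament.\<close>

lemma runs_out_program:
  fixes E :: "nat \<Rightarrow> nat \<Rightarrow> bool" and x :: "nat \<Rightarrow> rat" and n :: nat and t :: bool
  defines "R \<equiv> (\<lambda>i j. if t then E j i else E i j)"
  defines "val \<equiv> (\<lambda>i. x i + (\<Sum>j<n. if R i j then x j else 0))"
  assumes "encodes n E x s" "qreg s 0 = 0"
  shows "runs (out_program t) s (3 + 9 * n + 8 * n * n)
    (\<lambda>s'. qreg s' 0 = Max (insert 0 (val ` {..<n})))"
proof -
  define best where "best k = Max (insert 0 (val ` {..<k}))" for k
  have best_Suc: "best (Suc k) = max (best k) (val k)" for k
    by (simp only: best_def lessThan_Suc image_insert Max_insert_second finite_imageI finite_lessThan)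
  define I where "I k s \<longleftrightarrow> encodes n E x s \<and> qreg s 0 = best k" for k s
  \<comment> \<open>Invariant of the inner loop: m is the best weight so far, kept fixed while
    register 1 collects the candidate of vertex i.\<close>
  define J where "J i m k s \<longleftrightarrow> encodes n E x s \<and> ireg s 3 = i \<and> ireg s 4 = i * n \<and> qreg s 0 = m
    \<and> qreg s 1 = x i + (\<Sum>j<k. if R i j then x j else 0)" for i m k s
  have inner: "runs (For 5 6 (If_arc (if t then 6 else 4) (if t then 3 else 5)
        (Seq (Instr (QLoad 2 5)) (Instr (QAdd 1 1 2))))) s (3 + n * (5 + 3)) (J i m n)"
    if "i < n" "J i m 0 s" for i m s
  proof (rule runs_For)
    fix k s assume "k < n" "J i m k s" "ireg s 5 = k" "ireg s 6 = k * n"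
    then show "runs (If_arc (if t then 6 else 4) (if t then 3 else 5)
        (Seq (Instr (QLoad 2 5)) (Instr (QAdd 1 1 2)))) s 5
        (\<lambda>s'. J i m (Suc k) s' \<and> ireg s' 5 = k \<and> ireg s' 6 = k * n)"
      using \<open>i < n\<close> by (intro runs_loop_freeI) (auto simp: J_def encodes_def If_arc_def R_def)
  qed (use that in \<open>auto simp: J_def encodes_def\<close>)
  \<comment> \<open>The body costs 1 for the load, 3 + 8 * n for the inner loop and 2 for
    \<open>maximum_step\<close>.\<close>
  have "runs (out_program t) s (3 + n * ((6 + 8 * n) + 3)) (I n)"
    unfolding out_program_def
  proof (rule runs_For)
    fix k s assume k: "k < n" "I k s" "ireg s 3 = k" "ireg s 4 = k * n"
    let ?c = "For 5 6 (If_arc (if t then 6 else 4) (if t then 3 else 5)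
        (Seq (Instr (QLoad 2 5)) (Instr (QAdd 1 1 2))))"
    let ?Q = "\<lambda>s'. I (Suc k) s' \<and> ireg s' 3 = k \<and> ireg s' 4 = k * n"
    have first: "runs (Instr (QLoad 1 3)) s 1 (J k (qreg s 0) 0)"
      using k by (intro runs_loop_freeI) (auto simp: I_def J_def encodes_def)
    have last: "runs maximum_step s' 2 ?Q" if "J k (qreg s 0) n s'" for s'
    proof -
      have "encodes n E x s'" "ireg s' 3 = k" "ireg s' 4 = k * n" "qreg s' 1 = val k"
        "qreg s' 0 = best k"
        using that k(2) by (simp_all add: I_def J_def val_def)
      then show ?thesis
        unfolding I_def best_Suc
        by (intro runs_loop_freeI) (simp_all add: encodes_def maximum_step_def max_def)
    qed
    have "runs (Seq ?c maximum_step) s' (3 + n * (5 + 3) + 2) ?Q" if "J k (qreg s 0) 0 s'" for s'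
      by (rule runs_Seq, rule runs_mono[OF inner[OF k(1) that] order_refl last])
    then have "runs (Seq (Instr (QLoad 1 3)) (Seq ?c maximum_step)) s (1 + (3 + n * (5 + 3) + 2)) ?Q"
      by (rule runs_Seq[OF runs_mono[OF first order_refl]])
    then show "runs (Seq (Instr (QLoad 1 3)) (Seq ?c maximum_step)) s (6 + 8 * n) ?Q"
      by (rule runs_mono) auto
  qed (use assms in \<open>auto simp: I_def encodes_def best_def\<close>)
  then show ?thesis
    by (rule runs_mono) (auto simp: I_def best_def algebra_simps)
qed

section \<open>Maximum over all triples\<close>

definition triple_body :: program where
  "triple_body = Seq (Instr (QLoad 1 3))
     (Seq (If_arc 4 5 (Seq (Instr (QLoad 2 5)) (Instr (QAdd 1 1 2))))
     (Seq (If_arc 4 7 (If_arc 6 7 (Seq (Instr (QLoad 2 7)) (Instr (QAdd 1 1 2)))))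
     maximum_step))"

definition triple_program :: program where
  "triple_program = For 3 4 (For 5 6 (For 7 8 triple_body))"

text \<open>The triples already examined when the counters show i, j, k, that is, those
  lexicographically before (i, j, k).\<close>

definition lex_below :: "nat \<Rightarrow> nat \<Rightarrow> nat \<Rightarrow> nat \<Rightarrow> (nat \<times> nat \<times> nat) set" where
  "lex_below n i j k =
     {..<i} \<times> {..<n} \<times> {..<n} \<union> {i} \<times> {..<j} \<times> {..<n} \<union> {i} \<times> {j} \<times> {..<k}"

text \<open>The third and fourth equations are carries: a finished inner loop is the start of the
  next round of the enclosing one.\<close>

lemma lex_below_simps:
  "lex_below n 0 0 0 = {}"
  "lex_below n i j (Suc k) = insert (i, j, k) (lex_below n i j k)"
  "lex_below n i j n = lex_below n i (Suc j) 0"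
  "lex_below n i n 0 = lex_below n (Suc i) 0 0"
  "finite (lex_below n i j k)"
  by (auto simp: lex_below_def)

lemma runs_triple_program:
  fixes E :: "nat \<Rightarrow> nat \<Rightarrow> bool" and x :: "nat \<Rightarrow> rat" and n :: nat
  defines "val \<equiv> (\<lambda>(a, b, c). x a + (if E a b then x b else 0) + (if E a c \<and> E b c then x c else 0))"
  assumes "encodes n E x s" "qreg s 0 = 0"
  shows "runs triple_program s (3 + 6 * n + 6 * n * n + 19 * n * n * n)
    (\<lambda>s'. qreg s' 0 = Max (insert 0 (val ` ({..<n} \<times> {..<n} \<times> {..<n}))))"
proof -
  define best where "best i j k = Max (insert 0 (val ` lex_below n i j k))" for i j k
  have best_Suc: "best i j (Suc k) = max (best i j k)
      (x i + (if E i j then x j else 0) + (if E i k \<and> E j k then x k else 0))" for i j k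
    by (simp only: best_def lex_below_simps image_insert Max_insert_second finite_imageI)
      (simp add: val_def)
  define I where "I i j k s \<longleftrightarrow> encodes n E x s \<and> qreg s 0 = best i j k" for i j k s
  have inner: "runs (For 7 8 triple_body) s (3 + n * (16 + 3))
      (\<lambda>s. I i j n s \<and> ireg s 3 = i \<and> ireg s 4 = i * n \<and> ireg s 5 = j \<and> ireg s 6 = j * n)"
    if "i < n" "j < n" "I i j 0 s" "ireg s 3 = i" "ireg s 4 = i * n" "ireg s 5 = j" "ireg s 6 = j * n"
    for i j s
  proof (rule runs_For[where I = "\<lambda>k s. I i j k s \<and> ireg s 3 = i \<and> ireg s 4 = i * n
      \<and> ireg s 5 = j \<and> ireg s 6 = j * n"])
    fix k s
    assume "k < n" "I i j k s \<and> ireg s 3 = i \<and> ireg s 4 = i * n \<and> ireg s 5 = j \<and> ireg s 6 = j * n"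
      "ireg s 7 = k" "ireg s 8 = k * n"
    then show "runs triple_body s 16 (\<lambda>s'. (I i j (Suc k) s' \<and> ireg s' 3 = i \<and> ireg s' 4 = i * n
        \<and> ireg s' 5 = j \<and> ireg s' 6 = j * n) \<and> ireg s' 7 = k \<and> ireg s' 8 = k * n)"
      unfolding I_def best_Suc using \<open>i < n\<close> \<open>j < n\<close>
      by (intro runs_loop_freeI)
        (auto simp: encodes_def triple_body_def If_arc_def maximum_step_def max_def)
  qed (use that in \<open>auto simp: I_def encodes_def\<close>)
  have middle: "runs (For 5 6 (For 7 8 triple_body)) s (3 + n * ((3 + 19 * n) + 3))
      (\<lambda>s. I i n 0 s \<and> ireg s 3 = i \<and> ireg s 4 = i * n)"
    if "i < n" "I i 0 0 s" "ireg s 3 = i" "ireg s 4 = i * n" for i s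
  proof (rule runs_For[where I = "\<lambda>j s. I i j 0 s \<and> ireg s 3 = i \<and> ireg s 4 = i * n"])
    fix j s
    assume j: "j < n" "I i j 0 s \<and> ireg s 3 = i \<and> ireg s 4 = i * n" "ireg s 5 = j" "ireg s 6 = j * n"
    show "runs (For 7 8 triple_body) s (3 + 19 * n) (\<lambda>s'. (I i (Suc j) 0 s' \<and> ireg s' 3 = i
        \<and> ireg s' 4 = i * n) \<and> ireg s' 5 = j \<and> ireg s' 6 = j * n)"
      by (rule runs_mono[OF inner[OF \<open>i < n\<close> j(1)]])
        (use j in \<open>auto simp: I_def best_def lex_below_simps(3)\<close>)
  qed (use that in \<open>auto simp: I_def encodes_def\<close>)
  have "runs triple_program s (3 + n * ((3 + 6 * n + 19 * n * n) + 3)) (I n 0 0)"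
    unfolding triple_program_def
  proof (rule runs_For[where I = "\<lambda>i. I i 0 0"])
    fix i s assume i: "i < n" "I i 0 0 s" "ireg s 3 = i" "ireg s 4 = i * n"
    show "runs (For 5 6 (For 7 8 triple_body)) s (3 + 6 * n + 19 * n * n)
        (\<lambda>s'. I (Suc i) 0 0 s' \<and> ireg s' 3 = i \<and> ireg s' 4 = i * n)"
      by (rule runs_mono[OF middle[OF i]]) (auto simp: I_def best_def lex_below_simps(4) algebra_simps)
  qed (use assms in \<open>auto simp: I_def encodes_def best_def lex_below_simps\<close>)
  then show ?thesis
    by (rule runs_mono) (auto simp: I_def best_def algebra_simps lex_below_def)
qed

section \<open>Total weight minus the minima of the cyclic triangles\<close>

definition triangle_body :: program where
  "triangle_body = If_arc 4 5 (If_arc 6 7 (If_arc 8 3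
     (Cond (ILess 3 5) (Cond (ILess 3 7)
       (Seq (Instr (QLoad 1 3))
       (Seq (Instr (QLoad 2 5))
       (Seq (Cond (QLess 2 1) (Instr (QAdd 1 2 9)) Skip)
       (Seq (Instr (QLoad 2 7))
       (Seq (Cond (QLess 2 1) (Instr (QAdd 1 2 9)) Skip)
       (Instr (QSub 0 0 1))))))) Skip) Skip)))"

definition triangle_program :: program where
  "triangle_program = For 3 4 (Seq (Instr (QLoad 1 3)) (Seq (Instr (QAdd 0 0 1))
     (For 5 6 (For 7 8 triangle_body))))"

text \<open>The invariant \<open>I\<close> records the exact value m of register 0; the inner loops
  are verified for arbitrary initial m, so that their subtractions compose.\<close>

lemma runs_triangle_program:
  fixes E :: "nat \<Rightarrow> nat \<Rightarrow> bool" and x :: "nat \<Rightarrow> rat" and n :: nat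
  defines "g \<equiv> (\<lambda>a b c. if E a b \<and> E b c \<and> E c a \<and> a < b \<and> a < c
    then min (min (x a) (x b)) (x c) else 0)"
  assumes "encodes n E x s" "qreg s 0 = 0"
  shows "runs triangle_program s (3 + 8 * n + 6 * n * n + 22 * n * n * n)
    (\<lambda>s'. qreg s' 0 = (\<Sum>a<n. x a - (\<Sum>b<n. \<Sum>c<n. g a b c)))"
proof -
  define I where "I m s \<longleftrightarrow> encodes n E x s \<and> qreg s 0 = m" for m s
  have inner: "runs (For 7 8 triangle_body) s (3 + n * (19 + 3))
      (\<lambda>s. I (m - (\<Sum>c<n. g i j c)) s \<and> ireg s 3 = i \<and> ireg s 4 = i * n \<and> ireg s 5 = j \<and> ireg s 6 = j * n)"
    if "i < n" "j < n" "I m s" "ireg s 3 = i" "ireg s 4 = i * n" "ireg s 5 = j" "ireg s 6 = j * n"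
    for i j m s
  proof (rule runs_For[where I = "\<lambda>k s. I (m - (\<Sum>c<k. g i j c)) s \<and> ireg s 3 = i \<and> ireg s 4 = i * n
      \<and> ireg s 5 = j \<and> ireg s 6 = j * n"])
    fix k s
    assume "k < n" "I (m - (\<Sum>c<k. g i j c)) s \<and> ireg s 3 = i \<and> ireg s 4 = i * n
      \<and> ireg s 5 = j \<and> ireg s 6 = j * n" "ireg s 7 = k" "ireg s 8 = k * n"
    \<comment> \<open>Three arc tests at 3 each, two index comparisons, and 8 for computing and
      subtracting the minimum.\<close>
    then show "runs triangle_body s 19 (\<lambda>s'. (I (m - (\<Sum>c<Suc k. g i j c)) s' \<and> ireg s' 3 = i
        \<and> ireg s' 4 = i * n \<and> ireg s' 5 = j \<and> ireg s' 6 = j * n) \<and> ireg s' 7 = k \<and> ireg s' 8 = k * n)"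
      unfolding I_def g_def using \<open>i < n\<close> \<open>j < n\<close>
      by (intro runs_loop_freeI)
        (auto simp: encodes_def triangle_body_def If_arc_def min_def)
  qed (use that in \<open>auto simp: I_def encodes_def\<close>)
  have middle: "runs (For 5 6 (For 7 8 triangle_body)) s (3 + n * ((3 + 22 * n) + 3))
      (\<lambda>s. I (m - (\<Sum>b<n. \<Sum>c<n. g i b c)) s \<and> ireg s 3 = i \<and> ireg s 4 = i * n)"
    if "i < n" "I m s" "ireg s 3 = i" "ireg s 4 = i * n" for i m s
  proof (rule runs_For[where I = "\<lambda>j s. I (m - (\<Sum>b<j. \<Sum>c<n. g i b c)) s
      \<and> ireg s 3 = i \<and> ireg s 4 = i * n"])
    fix j s
    assume j: "j < n" "I (m - (\<Sum>b<j. \<Sum>c<n. g i b c)) s \<and> ireg s 3 = i \<and> ireg s 4 = i * n"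
      "ireg s 5 = j" "ireg s 6 = j * n"
    show "runs (For 7 8 triangle_body) s (3 + 22 * n) (\<lambda>s'. (I (m - (\<Sum>b<Suc j. \<Sum>c<n. g i b c)) s'
        \<and> ireg s' 3 = i \<and> ireg s' 4 = i * n) \<and> ireg s' 5 = j \<and> ireg s' 6 = j * n)"
      by (rule runs_mono[OF inner[OF \<open>i < n\<close> j(1)]]) (use j in \<open>auto simp: diff_diff_eq\<close>)
  qed (use that in \<open>auto simp: I_def encodes_def\<close>)
  have "runs triangle_program s (3 + n * ((5 + 6 * n + 22 * n * n) + 3))
      (I (\<Sum>a<n. x a - (\<Sum>b<n. \<Sum>c<n. g a b c)))"
    unfolding triangle_program_def
  proof (rule runs_For[where I = "\<lambda>i. I (\<Sum>a<i. x a - (\<Sum>b<n. \<Sum>c<n. g a b c))"])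
    fix i s
    let ?m = "\<Sum>a<i. x a - (\<Sum>b<n. \<Sum>c<n. g a b c)"
    let ?c = "For 5 6 (For 7 8 triangle_body)"
    let ?Q = "\<lambda>s'. I (\<Sum>a<Suc i. x a - (\<Sum>b<n. \<Sum>c<n. g a b c)) s' \<and> ireg s' 3 = i \<and> ireg s' 4 = i * n"
    assume i: "i < n" "I ?m s" "ireg s 3 = i" "ireg s 4 = i * n"
    define s' where "s' = run (Seq (Instr (QLoad 1 3)) (Instr (QAdd 0 0 1))) s"
    have "I (?m + x i) s'" "ireg s' 3 = i" "ireg s' 4 = i * n"
      using i by (auto simp: s'_def I_def encodes_def)
    from middle[OF i(1) this] have "runs ?c s' (3 + n * ((3 + 22 * n) + 3)) ?Q"
      by (rule runs_mono) (auto simp: algebra_simps)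
    then have "runs (Seq (Instr (QLoad 1 3)) (Seq (Instr (QAdd 0 0 1)) ?c)) s
        (1 + (1 + (3 + n * ((3 + 22 * n) + 3)))) ?Q"
      by (intro runs_Seq[OF runs_loop_freeI]) (simp_all add: s'_def)
    then show "runs (Seq (Instr (QLoad 1 3)) (Seq (Instr (QAdd 0 0 1)) ?c)) s (5 + 6 * n + 22 * n * n) ?Q"
      by (rule runs_mono) (auto simp: algebra_simps)
  qed (use assms in \<open>auto simp: I_def encodes_def\<close>)
  then show ?thesis
    by (rule runs_mono) (auto simp: I_def algebra_simps)
qed

section \<open>Polynomial-time solvability\<close>

text \<open>The inserted 0 is the weight of the empty set, which also covers a tournament without
  vertices.\<close>

lemma (in weighted_tournament_rel) is_max_weight_MaxI:
  assumes "finite A"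
    and "\<And>y. y \<in> A \<Longrightarrow> \<exists>S \<subseteq> V. triangle_free E S \<and> sum x S = y"
    and "\<And>S. \<lbrakk>S \<subseteq> V; triangle_free E S; S \<noteq> {}\<rbrakk> \<Longrightarrow> \<exists>y\<in>A. sum x S \<le> y"
  shows "is_max_weight V E x (Max (insert 0 A))"
  unfolding is_max_weight_def
proof (intro conjI allI impI)
  have "Max (insert 0 A) \<in> insert 0 A" using assms(1) by (intro Max_in) auto
  moreover have "\<exists>S \<subseteq> V. triangle_free E S \<and> sum x S = 0"
    by (intro exI[of _ "{}"]) (simp add: triangle_free_def)
  ultimately show "\<exists>S\<subseteq>V. triangle_free E S \<and> sum x S = Max (insert 0 A)"
    using assms(2) by (metis insertE)
next
  fix S assume S: "S \<subseteq> V" "triangle_free E S"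
  obtain y where "y \<in> insert 0 A" "sum x S \<le> y"
    using assms(3)[OF S] by (cases "S = {}") auto
  then show "sum x S \<le> Max (insert 0 A)"
    using assms(1) by (meson Max_ge finite_insert order_trans)
qed

lemma is_max_weight_converse:
  "is_max_weight V (\<lambda>u v. E v u) x m \<longleftrightarrow> is_max_weight V E x m"
  by (simp only: is_max_weight_def triangle_free_converse[of E])

text \<open>The input state lacks only the constant 1 in integer register 1.\<close>

lemma encodes_input_state:
  fixes G :: "('a, 'b) pre_digraph" and w :: "'a \<Rightarrow> rat"
  shows "encodes (length vs) (\<lambda>i j. i < length vs \<and> j < length vs \<and> vs ! i \<rightarrow>\<^bsub>G\<^esub> vs ! j)
    (\<lambda>i. w (vs ! i)) (instr_step (IConst 1 1) (input_state G w vs))"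
proof -
  have less: "i * n + j < n * n" if "i < n" "j < n" for i j n :: nat
  proof -
    have "i * n + j < Suc i * n" using that by simp
    also have "\<dots> \<le> n * n" using that by (intro mult_right_mono) auto
    finally show ?thesis .
  qed
  have div: "(i * n + j) div n = i" if "j < n" for i j n :: nat
    using that by simp
  show ?thesis
    by (auto simp: encodes_def input_state_def Let_def less div)
qed

text \<open>Reduces the claim to relations on indices; \<Phi> is the property of the index relation
  that the excluded pattern provides.\<close>

lemma WMISP_in_polynomial_timeI:
  assumes c: "\<And>n E x s. \<lbrakk>weighted_tournament_rel {..<n} E x; \<Phi> E; encodes n E x s; qreg s 0 = 0\<rbrakk>
      \<Longrightarrow> runs c s (poly p n) (\<lambda>s'. is_max_weight {..<n} E x (qreg s' 0))"
    and \<C>: "\<And>G. G \<in> \<C> \<Longrightarrow> tournament G"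
      "\<And>G vs. \<lbrakk>G \<in> \<C>; distinct vs; set vs = verts G\<rbrakk>
        \<Longrightarrow> \<Phi> (\<lambda>i j. i < length vs \<and> j < length vs \<and> vs ! i \<rightarrow>\<^bsub>G\<^esub> vs ! j)"
  shows "WMISP_in_polynomial_time \<C>"
proof -
  \<comment> \<open>The extra 1 in the time bound pays for setting the constant register.\<close>
  have "\<exists>t s. exec (Seq (Instr (IConst 1 1)) c) (input_state G w vs) t s \<and>
      t \<le> poly (1 + p) (card (verts G)) \<and> result s = max_independent_weight G w"
    if G: "G \<in> \<C>" and w: "\<forall>v \<in> verts G. 0 \<le> w v" and vs: "distinct vs" "set vs = verts G"
    for G w vs
  proof -
    interpret tournament_rel "verts G" "\<lambda>u v. u \<rightarrow>\<^bsub>G\<^esub> v"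
      using \<C>(1)[OF G] by (rule tournament.tournament_rel)
    let ?n = "length vs"
    let ?E = "\<lambda>i j. i < ?n \<and> j < ?n \<and> vs ! i \<rightarrow>\<^bsub>G\<^esub> vs ! j"
    let ?x = "\<lambda>i. w (vs ! i)"
    have "weighted_tournament_rel {..<?n} ?E ?x"
    proof
      show "?E i j \<or> ?E j i" if "i \<in> {..<?n}" "j \<in> {..<?n}" "i \<noteq> j" for i j
      proof -
        have "vs ! i \<noteq> vs ! j" "vs ! i \<in> verts G" "vs ! j \<in> verts G"
          using that vs(1) unfolding vs(2)[symmetric] by (simp_all add: nth_eq_iff_index_eq)
        then show ?thesis using E_total that by auto
      qed
    qed (use E_asym w vs in auto)
    then have "runs c (instr_step (IConst 1 1) (input_state G w vs)) (poly p ?n)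
        (\<lambda>s'. is_max_weight {..<?n} ?E ?x (qreg s' 0))"
      using \<C>(2)[OF G vs] encodes_input_state by (rule c) (simp add: input_state_def Let_def)
    then obtain t s where "exec c (instr_step (IConst 1 1) (input_state G w vs)) t s"
      "t \<le> poly p ?n" "is_max_weight {..<?n} ?E ?x (qreg s 0)"
      unfolding runs_def by blast
    moreover from this have "max_independent_weight G w = qreg s 0"
      using max_independent_weight_eqI[OF \<C>(1)[OF G] vs] by blast
    moreover have "card (verts G) = ?n" using vs distinct_card by metis
    ultimately show ?thesis
      unfolding result_def
      by (intro exI[of _ "1 + t"] exI[of _ s] conjI exec.Seq[OF exec.Instr]) simp_all
  qed
  then show ?thesis
    unfolding WMISP_in_polynomial_time_def by blast
qed

section \<open>Correctness of the three programs\<close>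

lemma triple_program_correct:
  assumes "weighted_tournament_rel {..<n} E x" and no: "\<forall>a b c d. \<not> transitive4 E a b c d"
    and "encodes n E x s" "qreg s 0 = 0"
  shows "runs triple_program s (poly [:3, 6, 6, 19:] n) (\<lambda>s'. is_max_weight {..<n} E x (qreg s' 0))"
proof -
  interpret weighted_tournament_rel "{..<n}" E x by fact
  have "is_max_weight {..<n} E x
    (Max (insert 0 ((\<lambda>(a, b, c). triple_weight a b c) ` ({..<n} \<times> {..<n} \<times> {..<n}))))"
  proof (rule is_max_weight_MaxI)
    fix S assume "S \<subseteq> {..<n}" "triangle_free E S" "S \<noteq> {}"
    then obtain a b c where "a \<in> {..<n}" "b \<in> {..<n}" "c \<in> {..<n}" "sum x S \<le> triple_weight a b c"
      using triangle_free_le_triple_weight no by metis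
    then show "\<exists>y\<in>(\<lambda>(a, b, c). triple_weight a b c) ` ({..<n} \<times> {..<n} \<times> {..<n}). sum x S \<le> y"
      by (intro bexI[of _ "triple_weight a b c"]) (auto intro!: image_eqI[of _ _ "(a, b, c)"])
  qed (use triple_weight_attained in auto)
  then show ?thesis
    by (intro runs_mono[OF runs_triple_program[OF assms(3,4)]])
      (simp_all add: triple_weight_def algebra_simps)
qed

lemma out_program_correct:
  assumes "weighted_tournament_rel {..<n} E x"
    and no: "\<forall>a b c d. \<not> winner4 (if t then \<lambda>u v. E v u else E) a b c d"
    and "encodes n E x s" "qreg s 0 = 0"
  shows "runs (out_program t) s (poly [:3, 9, 8:] n) (\<lambda>s'. is_max_weight {..<n} E x (qreg s' 0))"
proof -
  define R where "R = (if t then \<lambda>u v. E v u else E)"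
  interpret W: weighted_tournament_rel "{..<n}" E x by fact
  interpret R: weighted_tournament_rel "{..<n}" R x
    unfolding R_def weighted_tournament_rel_def
    using W.converse W.tournament_rel_axioms W.weighted_tournament_rel_axioms
    by (simp add: weighted_tournament_rel_axioms_def W.x_nonneg)
  have "is_max_weight {..<n} R x (Max (insert 0 (R.out_weight ` {..<n})))"
  proof (rule R.is_max_weight_MaxI)
    show "\<exists>S\<subseteq>{..<n}. triangle_free R S \<and> sum x S = y" if "y \<in> R.out_weight ` {..<n}" for y
      using that R.out_weight_attained no unfolding R_def[symmetric] by blast
    show "\<exists>y\<in>R.out_weight ` {..<n}. sum x S \<le> y"
      if "S \<subseteq> {..<n}" "triangle_free R S" "S \<noteq> {}" for S
      using R.triangle_free_le_out_weight[OF that] by blast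
  qed simp
  \<comment> \<open>Reversing all arcs changes neither independence nor weights.\<close>
  then have "is_max_weight {..<n} E x (Max (insert 0 (R.out_weight ` {..<n})))"
    by (cases t) (simp_all add: R_def is_max_weight_converse[of _ E])
  moreover have "R.out_weight = (\<lambda>i. x i + (\<Sum>j<n. if if t then E j i else E i j then x j else 0))"
    unfolding R.out_weight_def[abs_def] by (auto simp: R_def)
  ultimately show ?thesis
    by (intro runs_mono[OF runs_out_program[OF assms(3,4)]]) (simp_all add: algebra_simps)
qed

lemma triangle_program_correct:
  assumes "weighted_tournament_rel {..<n} E x" and no: "\<forall>a b c d. \<not> strong4 E a b c d"
    and "encodes n E x s" "qreg s 0 = 0"
  shows "runs triangle_program s (poly [:3, 8, 6, 22:] n) (\<lambda>s'. is_max_weight {..<n} E x (qreg s' 0))"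
proof -
  interpret strong4_free_rel "{..<n}" E x
    using assms by (intro strong4_free_rel.intro strong4_free_rel_axioms.intro) auto
  show ?thesis
    using is_max_weight_triangle_sums unfolding triangle_min_def
    by (intro runs_mono[OF runs_triangle_program[OF assms(3,4)]]) (simp_all add: algebra_simps)
qed

theorem theorem1p2:
  fixes H :: "('a, 'b) pre_digraph"
  assumes "tournament H"
    and "card (verts H) = 4"
  shows "WMISP_in_polynomial_time {G. tournament G \<and> free_of H G}"
proof -
  define F where "F = (\<lambda>u v. u \<rightarrow>\<^bsub>H\<^esub> v)"
  interpret tournament_rel "verts H" F
    unfolding F_def using assms(1) by (rule tournament.tournament_rel)
  obtain xs where xs: "set xs = verts H" "distinct xs" "length xs = 4"
    using finite_distinct_list[OF finite_V] assms(2) distinct_card by metis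
  then obtain p q r s where "xs = [p, q, r, s]"
    by (auto simp: numeral_eq_Suc length_Suc_conv)
  with xs have pqrs: "verts H = {p, q, r, s}" "distinct [p, q, r, s]" by auto
  obtain a b c d where "{a, b, c, d} = {p, q, r, s}"
    and pat: "transitive4 F a b c d \<or> winner4 F a b c d \<or> winner4 (\<lambda>u v. F v u) a b c d \<or> strong4 F a b c d"
    using pattern4_cases[OF _ _ _ _ pqrs(2)] pqrs(1) by blast
  then have V: "verts H = {a, b, c, d}" using pqrs(1) by simp
  let ?C = "{G :: (nat, nat \<times> nat) pre_digraph. tournament G \<and> free_of H G}"
  let ?E = "\<lambda>G (vs :: nat list) i j. i < length vs \<and> j < length vs \<and> vs ! i \<rightarrow>\<^bsub>G\<^esub> vs ! j"
  \<comment> \<open>H realizes some pattern on a, b, c, d; the same pattern on indices i, j, k, l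
    would embed H into G through \<open>vs\<close>.\<close>
  have no_pattern: "\<not> (transitive4 F a b c d \<and> transitive4 (?E G vs) i j k l
      \<or> winner4 F a b c d \<and> winner4 (?E G vs) i j k l
      \<or> winner4 (\<lambda>u v. F v u) a b c d \<and> winner4 (\<lambda>u v. ?E G vs v u) i j k l
      \<or> strong4 F a b c d \<and> strong4 (?E G vs) i j k l)" (is "\<not> ?P")
    if "G \<in> ?C" for G vs i j k l
  proof
    assume ?P
    then have "transitive4 F a b c d \<and> transitive4 (\<lambda>u v. u \<rightarrow>\<^bsub>G\<^esub> v) (vs ! i) (vs ! j) (vs ! k) (vs ! l)
      \<or> winner4 F a b c d \<and> winner4 (\<lambda>u v. u \<rightarrow>\<^bsub>G\<^esub> v) (vs ! i) (vs ! j) (vs ! k) (vs ! l)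
      \<or> winner4 (\<lambda>u v. F v u) a b c d
        \<and> winner4 (\<lambda>u v. v \<rightarrow>\<^bsub>G\<^esub> u) (vs ! i) (vs ! j) (vs ! k) (vs ! l)
      \<or> strong4 F a b c d \<and> strong4 (\<lambda>u v. u \<rightarrow>\<^bsub>G\<^esub> v) (vs ! i) (vs ! j) (vs ! k) (vs ! l)"
      unfolding pattern4_defs by argo
    then have "\<not> free_of H G"
      using that unfolding F_def by (intro not_free_of_pattern4[OF assms(1) _ V]) auto
    then show False using that by blast
  qed
  from pat show ?thesis
  proof (elim disjE)
    assume "transitive4 F a b c d"
    then have "\<forall>i j k l. \<not> transitive4 (?E G vs) i j k l" if "G \<in> ?C" for G vs
      using no_pattern[OF that] by blast
    then show ?thesis
      by (intro WMISP_in_polynomial_timeI[where \<Phi> = "\<lambda>E. \<forall>i j k l. \<not> transitive4 E i j k l",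
            OF triple_program_correct]) simp_all
  next
    assume "winner4 F a b c d"
    then have "\<forall>i j k l. \<not> winner4 (?E G vs) i j k l" if "G \<in> ?C" for G vs
      using no_pattern[OF that] by blast
    then show ?thesis
      by (intro WMISP_in_polynomial_timeI[where \<Phi> = "\<lambda>E. \<forall>i j k l. \<not> winner4 E i j k l",
            OF out_program_correct[where t = False]]) simp_all
  next
    assume "winner4 (\<lambda>u v. F v u) a b c d"
    then have "\<forall>i j k l. \<not> winner4 (\<lambda>u v. ?E G vs v u) i j k l" if "G \<in> ?C" for G vs
      using no_pattern[OF that] by blast
    then show ?thesis
      by (intro WMISP_in_polynomial_timeI[where \<Phi> = "\<lambda>E. \<forall>i j k l. \<not> winner4 (\<lambda>u v. E v u) i j k l",
            OF out_program_correct[where t = True]]) simp_all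
  next
    assume "strong4 F a b c d"
    then have "\<forall>i j k l. \<not> strong4 (?E G vs) i j k l" if "G \<in> ?C" for G vs
      using no_pattern[OF that] by blast
    then show ?thesis
      by (intro WMISP_in_polynomial_timeI[where \<Phi> = "\<lambda>E. \<forall>i j k l. \<not> strong4 E i j k l",
            OF triangle_program_correct]) simp_all
  qed
qed

end
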